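(* Let $\mathcal{G}=\begin{pmatrix}\mathcal{A}&\mathcal{M}\\ \mathcal{N}&\mathcal{B}\end{pmatrix}$ be a generalized matrix algebra whose modules $\mathcal{M}$ and $\mathcal{N}$ are $2$-torsion free, and suppose $\mathcal{M}$ is a faithful $(\mathcal{A},\mathcal{B})$-module. Then $\mathcal{G}$ has the Lie derivation property if (i) $\pi_{\mathcal{A}}(Z(\mathcal{G}))=Z(\mathcal{A})$ and $\pi_{\mathcal{B}}(Z(\mathcal{G}))=Z(\mathcal{B})$, and (ii) $\mathcal{A}$ and $\mathcal{B}$ are domains.
   Context: All algebras are unital algebras over a fixed commutative unital ring $\mathbf{R}$; linear means $\mathbf{R}$-linear; $Z(\cdot)$ denotes the center; $[a,b]=ab-ba$. A module $\mathcal{M}$ is $2$-torsion free if $2m=0$ implies $m=0$ for $m\in\mathcal{M}$. Generalized matrix algebra: a Morita context consists of unital algebras $\mathcal{A},\mathcal{B}$, an $(\mathcal{A},\mathcal{B})$-bimodule $\mathcal{M}$, a $(\mathcal{B},\mathcal{A})$-bimodule $\mathcal{N}$, and bimodule homomorphisms $\Phi:\mathcal{M}\otimes_{\mathcal{B}}\mathcal{N}\to\mathcal{A}$, $\Psi:\mathcal{N}\otimes_{\mathcal{A}}\mathcal{M}\to\mathcal{B}$ such that, writing $mn=\Phi(m\otimes n)$ and $nm=\Psi(n\otimes m)$, one has $(mn)m'=m(nm')$ and $(nm)n'=n(mn')$ for all $m,m'\in\mathcal{M}$, $n,n'\in\mathcal{N}$. Then the set $\mathcal{G}$ of matrices $\begin{pmatrix}a&m\\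 n&b\end{pmatrix}$ ($a\in\mathcal{A}$, $m\in\mathcal{M}$, $n\in\mathcal{N}$, $b\in\mathcal{B}$), with the usual matrix operations, is an algebra, called a generalized matrix algebra; it is assumed that at least one of $\mathcal{M},\mathcal{N}$ is nonzero. Writing $a\oplus b$ for the diagonal matrix $\begin{pmatrix}a&0\\0&b\end{pmatrix}$, the center is $Z(\mathcal{G})=\{a\oplus b: a\in Z(\mathcal{A}),\,b\in Z(\mathcal{B}),\ am=mb,\ na=bn\ \text{for all } m\in\mathcal{M},n\in\mathcal{N}\}$. The projections $\pi_{\mathcal{A}}:\mathcal{G}\to\mathcal{A}$ and $\pi_{\mathcal{B}}:\mathcal{G}\to\mathcal{B}$ send $\begin{pmatrix}a&m\\ n&b\end{pmatrix}$ to $a$ and to $b$, respectively. $\mathcal{M}$ is a faithful $(\mathcal{A},\mathcal{B})$-module if $a\mathcal{M}=0$ implies $a=0$ (for $a\in\mathcal{A}$) and $\mathcal{M}b=0$ implies $b=0$ (for $b\in\mathcal{B}$). An algebra $\mathcal{A}$ (not necessarily commutative) is a domain if $aa'=0$ implies $a=0$ or $a'=0$ for all $a,a'\in\mathcal{A}$. A derivation of an algebra $\mathcal{C}$ is a linear map $\mathcal{D}:\mathcal{C}\to\mathcal{C}$ with $\mathcal{D}(xy)=\mathcal{D}(x)y+x\mathcal{D}(y)$. A Lie derivation is a linear map $\mathcal{L}:\mathcal{C}\to\mathcal{C}$ with $\mathcal{L}([x,y])=[\mathcal{L}(x),y]+[x,\mathcal{L}(y)]$. A Lie derivation $\mathcal{L}$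 is proper if $\mathcal{L}=\mathcal{D}+\tau$ with $\mathcal{D}:\mathcal{C}\to\mathcal{C}$ a derivation and $\tau:\mathcal{C}\to Z(\mathcal{C})$ linear. The algebra $\mathcal{C}$ has the Lie derivation property if every Lie derivation $\mathcal{C}\to\mathcal{C}$ is proper. *)

theory Defs
  imports Complex_Main
begin

section \<open>Algebras over a commutative ring\<close>

definition bilinear_map ::
    "('r::comm_ring_1 \<Rightarrow> 'x::ab_group_add \<Rightarrow> 'x) \<Rightarrow> ('r \<Rightarrow> 'y::ab_group_add \<Rightarrow> 'y) \<Rightarrow>
     ('r \<Rightarrow> 'z::ab_group_add \<Rightarrow> 'z) \<Rightarrow> ('x \<Rightarrow> 'y \<Rightarrow> 'z) \<Rightarrow> bool" where
  "bilinear_map s1 s2 s3 h \<longleftrightarrow>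
     (\<forall>x. module_hom s2 s3 (h x)) \<and> (\<forall>y. module_hom s1 s3 (\<lambda>x. h x y))"

text \<open>The multiplication is a parameter and not the one of a type class, because the product of
  generalized matrices depends on the Morita context.\<close>

locale unital_algebra = module scale
  for scale :: "'r::comm_ring_1 \<Rightarrow> 'c::ab_group_add \<Rightarrow> 'c" +
  fixes mult :: "'c \<Rightarrow> 'c \<Rightarrow> 'c" and one :: 'c
  assumes mult_bilinear: "bilinear_map scale scale scale mult"
    and mult_assoc: "mult (mult x y) z = mult x (mult y z)"
    and mult_one_left: "mult one x = x"
    and mult_one_right: "mult x one = x"

definition center :: "('c \<Rightarrow> 'c \<Rightarrow> 'c) \<Rightarrow> 'c set" where
  "center mult = {z. \<forall>x. mult z x = mult x z}"

definition commutator :: "('c::ab_group_add \<Rightarrow> 'c \<Rightarrow> 'c) \<Rightarrow> 'c \<Rightarrow> 'c \<Rightarrow> 'c" where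
  "commutator mult x y = mult x y - mult y x"

definition is_domain :: "('c::zero \<Rightarrow> 'c \<Rightarrow> 'c) \<Rightarrow> bool" where
  "is_domain mult \<longleftrightarrow> (\<forall>x y. mult x y = 0 \<longrightarrow> x = 0 \<or> y = 0)"

definition derivation ::
    "('r::comm_ring_1 \<Rightarrow> 'c::ab_group_add \<Rightarrow> 'c) \<Rightarrow> ('c \<Rightarrow> 'c \<Rightarrow> 'c) \<Rightarrow> ('c \<Rightarrow> 'c) \<Rightarrow> bool" where
  "derivation scale mult D \<longleftrightarrow>
     module_hom scale scale D \<and> (\<forall>x y. D (mult x y) = mult (D x) y + mult x (D y))"

definition lie_derivation ::
    "('r::comm_ring_1 \<Rightarrow> 'c::ab_group_add \<Rightarrow> 'c) \<Rightarrow> ('c \<Rightarrow> 'c \<Rightarrow> 'c) \<Rightarrow> ('c \<Rightarrow> 'c) \<Rightarrow> bool" where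
  "lie_derivation scale mult L \<longleftrightarrow>
     module_hom scale scale L \<and>
     (\<forall>x y. L (commutator mult x y) = commutator mult (L x) y + commutator mult x (L y))"

definition proper_lie_derivation ::
    "('r::comm_ring_1 \<Rightarrow> 'c::ab_group_add \<Rightarrow> 'c) \<Rightarrow> ('c \<Rightarrow> 'c \<Rightarrow> 'c) \<Rightarrow> ('c \<Rightarrow> 'c) \<Rightarrow> bool" where
  "proper_lie_derivation scale mult L \<longleftrightarrow>
     lie_derivation scale mult L \<and>
     (\<exists>D \<tau>. derivation scale mult D \<and> module_hom scale scale \<tau> \<and> range \<tau> \<subseteq> center mult \<and>
        (\<forall>x. L x = D x + \<tau> x))"

definition lie_derivation_property ::
    "('r::comm_ring_1 \<Rightarrow> 'c::ab_group_add \<Rightarrow> 'c) \<Rightarrow> ('c \<Rightarrow> 'c \<Rightarrow> 'c) \<Rightarrow> bool" where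
  "lie_derivation_property scale mult \<longleftrightarrow>
     (\<forall>L. lie_derivation scale mult L \<longrightarrow> proper_lie_derivation scale mult L)"

section \<open>Bimodules and Morita contexts\<close>

text \<open>Bilinearity of the actions says that the module structure over the ground ring is compatible
  with both actions. The class \<^class>\<open>ring_1\<close> contains \<open>0 \<noteq> 1\<close>; nothing is lost, since over a
  zero algebra every unital bimodule is zero, and the modules of a generalized
  matrix algebra are not both zero.\<close>

locale bimodule =
  A: unital_algebra scaleA "(*)" 1 + B: unital_algebra scaleB "(*)" 1 + M: module scaleM
  for scaleA :: "'r::comm_ring_1 \<Rightarrow> 'a::ring_1 \<Rightarrow> 'a"
    and scaleB :: "'r \<Rightarrow> 'b::ring_1 \<Rightarrow> 'b"
    and scaleM :: "'r \<Rightarrow> 'm::ab_group_add \<Rightarrow> 'm" +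
  fixes lact :: "'a \<Rightarrow> 'm \<Rightarrow> 'm" and ract :: "'m \<Rightarrow> 'b \<Rightarrow> 'm"
  assumes lact_bilinear: "bilinear_map scaleA scaleM scaleM lact"
    and ract_bilinear: "bilinear_map scaleM scaleB scaleM ract"
    and lact_one: "lact 1 m = m"
    and ract_one: "ract m 1 = m"
    and lact_mult: "lact (a * a') m = lact a (lact a' m)"
    and ract_mult: "ract m (b * b') = ract (ract m b) b'"
    and lact_ract: "ract (lact a m) b = lact a (ract m b)"

definition faithful_bimodule ::
    "('a::zero \<Rightarrow> 'm::zero \<Rightarrow> 'm) \<Rightarrow> ('m \<Rightarrow> 'b::zero \<Rightarrow> 'm) \<Rightarrow> bool" where
  "faithful_bimodule lact ract \<longleftrightarrow>
     (\<forall>a. (\<forall>m. lact a m = 0) \<longrightarrow> a = 0) \<and> (\<forall>b. (\<forall>m. ract m b = 0) \<longrightarrow> b = 0)"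

definition two_torsion_free :: "'m::ab_group_add set \<Rightarrow> bool" where
  "two_torsion_free S \<longleftrightarrow> (\<forall>m\<in>S. m + m = 0 \<longrightarrow> m = 0)"

text \<open>A bimodule homomorphism \<open>\<Phi> : M \<otimes>\<^sub>B N \<rightarrow> A\<close> is given, via the universal property of the tensor
  product, as the bilinear, \<open>B\<close>-balanced map \<open>mn m n = \<Phi> (m \<otimes> n)\<close> that respects the outer actions
  of \<open>A\<close>; \<open>nm n m = \<Psi> (n \<otimes> m)\<close> likewise.\<close>

locale morita_context =
  M: bimodule scaleA scaleB scaleM lM rM + N: bimodule scaleB scaleA scaleN lN rN
  for scaleA :: "'r::comm_ring_1 \<Rightarrow> 'a::ring_1 \<Rightarrow> 'a"
    and scaleB :: "'r \<Rightarrow> 'b::ring_1 \<Rightarrow> 'b"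
    and scaleM :: "'r \<Rightarrow> 'm::ab_group_add \<Rightarrow> 'm"
    and scaleN :: "'r \<Rightarrow> 'n::ab_group_add \<Rightarrow> 'n"
    and lM :: "'a \<Rightarrow> 'm \<Rightarrow> 'm" and rM :: "'m \<Rightarrow> 'b \<Rightarrow> 'm"
    and lN :: "'b \<Rightarrow> 'n \<Rightarrow> 'n" and rN :: "'n \<Rightarrow> 'a \<Rightarrow> 'n" +
  fixes mn :: "'m \<Rightarrow> 'n \<Rightarrow> 'a" and nm :: "'n \<Rightarrow> 'm \<Rightarrow> 'b"
  assumes mn_bilinear: "bilinear_map scaleM scaleN scaleA mn"
    and mn_balanced: "mn (rM m b) n = mn m (lN b n)"
    and mn_left: "mn (lM a m) n = a * mn m n"
    and mn_right: "mn m (rN n a) = mn m n * a"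
    and nm_bilinear: "bilinear_map scaleN scaleM scaleB nm"
    and nm_balanced: "nm (rN n a) m = nm n (lM a m)"
    and nm_left: "nm (lN b n) m = b * nm n m"
    and nm_right: "nm n (rM m b) = nm n m * b"
    and mn_act: "lM (mn m n) m' = rM m (nm n m')"
    and nm_act: "lN (nm n m) n' = rN n (mn m n')"

section \<open>Generalized matrix algebras\<close>

datatype ('a, 'm, 'n, 'b) gmat =
  GMat (entryA: 'a) (entryM: 'm) (entryN: 'n) (entryB: 'b)

instantiation gmat :: (ab_group_add, ab_group_add, ab_group_add, ab_group_add) ab_group_add
begin

definition "0 = GMat 0 0 0 0"
definition "x + y = GMat (entryA x + entryA y) (entryM x + entryM y)
                         (entryN x + entryN y) (entryB x + entryB y)"
definition "- x = GMat (- entryA x) (- entryM x) (- entryN x) (- entryB x)"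
definition "x - y = GMat (entryA x - entryA y) (entryM x - entryM y)
                         (entryN x - entryN y) (entryB x - entryB y)"

instance
  by standard
    (auto simp: zero_gmat_def plus_gmat_def uminus_gmat_def minus_gmat_def algebra_simps
      intro: gmat.expand)

end

definition gmat_scale ::
    "('r \<Rightarrow> 'a \<Rightarrow> 'a) \<Rightarrow> ('r \<Rightarrow> 'm \<Rightarrow> 'm) \<Rightarrow> ('r \<Rightarrow> 'n \<Rightarrow> 'n) \<Rightarrow> ('r \<Rightarrow> 'b \<Rightarrow> 'b) \<Rightarrow>
     'r \<Rightarrow> ('a, 'm, 'n, 'b) gmat \<Rightarrow> ('a, 'm, 'n, 'b) gmat" where
  "gmat_scale scaleA scaleM scaleN scaleB r x =
     GMat (scaleA r (entryA x)) (scaleM r (entryM x)) (scaleN r (entryN x)) (scaleB r (entryB x))"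

definition gmat_mult ::
    "('a::ring_1 \<Rightarrow> 'm::ab_group_add \<Rightarrow> 'm) \<Rightarrow> ('m \<Rightarrow> 'b::ring_1 \<Rightarrow> 'm) \<Rightarrow>
     ('b \<Rightarrow> 'n::ab_group_add \<Rightarrow> 'n) \<Rightarrow> ('n \<Rightarrow> 'a \<Rightarrow> 'n) \<Rightarrow> ('m \<Rightarrow> 'n \<Rightarrow> 'a) \<Rightarrow> ('n \<Rightarrow> 'm \<Rightarrow> 'b) \<Rightarrow>
     ('a, 'm, 'n, 'b) gmat \<Rightarrow> ('a, 'm, 'n, 'b) gmat \<Rightarrow> ('a, 'm, 'n, 'b) gmat" where
  "gmat_mult lM rM lN rN mn nm x y =
     GMat (entryA x * entryA y + mn (entryM x) (entryN y))
          (lM (entryA x) (entryM y) + rM (entryM x) (entryB y))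
          (rN (entryN x) (entryA y) + lN (entryB x) (entryN y))
          (nm (entryN x) (entryM y) + entryB x * entryB y)"

locale generalized_matrix_algebra =
  morita_context scaleA scaleB scaleM scaleN lM rM lN rN mn nm
  for scaleA :: "'r::comm_ring_1 \<Rightarrow> 'a::ring_1 \<Rightarrow> 'a"
    and scaleB :: "'r \<Rightarrow> 'b::ring_1 \<Rightarrow> 'b"
    and scaleM :: "'r \<Rightarrow> 'm::ab_group_add \<Rightarrow> 'm"
    and scaleN :: "'r \<Rightarrow> 'n::ab_group_add \<Rightarrow> 'n"
    and lM rM lN rN mn nm +
  assumes nontrivial: "(\<exists>m::'m. m \<noteq> 0) \<or> (\<exists>n::'n. n \<noteq> 0)"

lemma bilinear_mapD:
  assumes "bilinear_map s1 s2 s3 h"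
  shows "h (x + x') y = h x y + h x' y" "h x (y + y') = h x y + h x y'"
    "h (s1 r x) y = s3 r (h x y)" "h x (s2 r y) = s3 r (h x y)" "h 0 y = 0" "h x 0 = 0"
  using assms unfolding bilinear_map_def
  by (auto dest: module_hom.add module_hom.scale module_hom.zero)

context morita_context
begin

lemmas bilinear_simps =
  bilinear_mapD[OF M.A.mult_bilinear] bilinear_mapD[OF M.B.mult_bilinear]
  bilinear_mapD[OF M.lact_bilinear] bilinear_mapD[OF M.ract_bilinear]
  bilinear_mapD[OF N.lact_bilinear] bilinear_mapD[OF N.ract_bilinear]
  bilinear_mapD[OF mn_bilinear] bilinear_mapD[OF nm_bilinear]

lemma unital_algebra_gmat:
  "unital_algebra (gmat_scale scaleA scaleM scaleN scaleB) (gmat_mult lM rM lN rN mn nm)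
     (GMat 1 0 0 1)"
proof -
  let ?s = "gmat_scale scaleA scaleM scaleN scaleB"
  let ?m = "gmat_mult lM rM lN rN mn nm"
  interpret G: module ?s
    by unfold_locales
      (simp_all add: gmat_scale_def plus_gmat_def M.A.scale_right_distrib M.A.scale_left_distrib
        M.B.scale_right_distrib M.B.scale_left_distrib M.M.scale_right_distrib
        M.M.scale_left_distrib N.M.scale_right_distrib N.M.scale_left_distrib)
  show ?thesis
  proof
    have "module_hom ?s ?s (?m x)" "module_hom ?s ?s (\<lambda>y. ?m y x)" for x
      by unfold_locales
        (simp_all add: gmat_mult_def gmat_scale_def plus_gmat_def bilinear_simps
          M.A.scale_right_distrib M.B.scale_right_distrib M.M.scale_right_distrib
          N.M.scale_right_distrib)
    then show "bilinear_map ?s ?s ?s ?m"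
      by (simp add: bilinear_map_def)
  next
    show "?m (?m x y) z = ?m x (?m y z)" for x y z
      by (simp add: gmat_mult_def bilinear_simps M.lact_mult M.ract_mult M.lact_ract N.lact_mult
          N.ract_mult N.lact_ract mn_balanced mn_left mn_right nm_balanced nm_left nm_right mn_act
          nm_act mult.assoc add_ac)
  qed (simp_all add: gmat_mult_def bilinear_simps M.lact_one M.ract_one N.lact_one N.ract_one)
qed

lemma center_gmat:
  "center (gmat_mult lM rM lN rN mn nm) =
     {GMat a 0 0 b |a b. a \<in> center (*) \<and> b \<in> center (*) \<and>
        (\<forall>m. lM a m = rM m b) \<and> (\<forall>n. rN n a = lN b n)}"  (is "center ?m = ?Z")
proof (intro equalityI subsetI)
  fix z assume z: "z \<in> center ?m"
  then have *: "?m z x = ?m x z" for x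
    by (simp add: center_def)
  obtain a m n b where zd: "z = GMat a m n b" by (cases z)
  note simps = zd gmat_mult_def bilinear_simps M.lact_one M.ract_one N.lact_one N.ract_one
  have "m = 0" "n = 0"
    using *[of "GMat 1 0 0 0"] by (simp_all add: simps)
  moreover have "a \<in> center (*)" "b \<in> center (*)"
    using *[of "GMat _ 0 0 0"] *[of "GMat 0 0 0 _"] by (auto simp: center_def simps)
  moreover have "lM a m' = rM m' b" "rN n' a = lN b n'" for m' n'
    using *[of "GMat 0 m' 0 0"] *[of "GMat 0 0 n' 0"] by (auto simp: simps)
  ultimately show "z \<in> ?Z"
    using zd by auto
next
  fix z assume "z \<in> ?Z"
  then show "z \<in> center ?m"
    by (auto simp: center_def gmat_mult_def bilinear_simps)
qed

end

end

theory Submission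
  imports Defs
begin

text \<open>Let \<open>p = 1 \<oplus> 0\<close>, and let \<open>L\<close> be a Lie derivation of the generalized matrix algebra. Subtracting
  the inner derivation \<open>x \<mapsto> [[L p, p], x]\<close> makes \<open>L p\<close> diagonal. As \<open>[p, -]\<close> acts on the entries
  \<open>A\<close>, \<open>M\<close>, \<open>N\<close>, \<open>B\<close> as \<open>0\<close>, \<open>1\<close>, \<open>-1\<close>, \<open>0\<close> and there is no 2-torsion in \<open>M\<close> and \<open>N\<close>, the map \<open>L\<close>
  then preserves \<open>M\<close>, \<open>N\<close> and the diagonal, so that
  \<open>L (a, m, n, b) = (\<delta> a + k b, f m, g n, h a + \<epsilon> b)\<close>.

  Since \<open>[a, b] = 0\<close>, the maps \<open>h\<close> and \<open>k\<close> take central values. By the hypothesis on the projections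
  of the center and by faithfulness of \<open>M\<close>, every central \<open>b\<close> has a unique partner \<open>\<phi> b\<close> with
  \<open>\<phi> b \<oplus> b\<close> central, and every central \<open>a\<close> has a unique partner \<open>\<psi> a\<close>. Put \<open>d = \<delta> - \<phi> \<circ> h\<close> and
  \<open>e = \<epsilon> - \<psi> \<circ> k\<close>. Then \<open>L\<close> differs from \<open>D (a, m, n, b) = (d a, f m, g n, e b)\<close> by a map with
  central values, and \<open>D\<close> obeys the Leibniz rule for each product of two entries, except perhaps for
  \<open>mn\<close> and \<open>nm\<close>. For these, the identity for \<open>[m, n]\<close> leaves a central defect \<open>z \<oplus> w\<close>, where
  \<open>z = \<phi> (h (mn)) - k (nm)\<close> and \<open>z = f m n + m g n - d (mn)\<close>.

  Evaluating \<open>f (m n m)\<close> in two ways gives \<open>2 z m = 0\<close>, hence \<open>z m = 0 = m w\<close>, and therefore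
  \<open>z (mn) = 0\<close> and \<open>(nm) w = 0\<close>. If the defect were nonzero, then \<open>z\<close> and \<open>w\<close> would both be nonzero by
  faithfulness, and in the domains \<open>A\<close> and \<open>B\<close> this would force \<open>mn = 0\<close> and \<open>nm = 0\<close>; but then the
  first formula for \<open>z\<close> gives \<open>z = 0\<close>. So the defect vanishes and \<open>D\<close> is a derivation.\<close>

section \<open>Inner derivations and the center\<close>

lemma bilinear_map_diff:
  assumes "bilinear_map s1 s2 s3 h"
  shows "h (x - x') y = h x y - h x' y" "h x (y - y') = h x y - h x y'"
    "h (- x) y = - h x y" "h x (- y) = - h x y"
  using assms module_hom.diff[of s1 s3 "\<lambda>x. h x y"] module_hom.diff[of s2 s3 "h x"]
    module_hom.neg[of s1 s3 "\<lambda>x. h x y"] module_hom.neg[of s2 s3 "h x"]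
  by (simp_all add: bilinear_map_def)

context unital_algebra
begin

lemmas mult_simps = bilinear_mapD[OF mult_bilinear] bilinear_map_diff[OF mult_bilinear]

lemma module_hom_mult: "module_hom scale scale (mult s)" "module_hom scale scale (\<lambda>x. mult x s)"
  using mult_bilinear by (simp_all add: bilinear_map_def)

lemma module_hom_add_diff:
  assumes "module_hom scale scale F" "module_hom scale scale H"
  shows "module_hom scale scale (\<lambda>x. F x + H x)" "module_hom scale scale (\<lambda>x. F x - H x)"
proof -
  interpret P: module_pair scale scale ..
  show "module_hom scale scale (\<lambda>x. F x + H x)" "module_hom scale scale (\<lambda>x. F x - H x)"
    using assms by (rule P.module_hom_add P.module_hom_sub)+
qed

lemma derivation_inner: "derivation scale mult (commutator mult s)"
proof -
  have "module_hom scale scale (commutator mult s)"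
    using module_hom_add_diff(2)[OF module_hom_mult] by (simp add: commutator_def[abs_def])
  then show ?thesis
    by (simp add: derivation_def commutator_def mult_simps mult_assoc)
qed

lemma lie_derivation_diff_derivation:
  assumes "lie_derivation scale mult L" "derivation scale mult D"
  shows "lie_derivation scale mult (\<lambda>x. L x - D x)"
proof -
  have L: "module_hom scale scale L"
    "L (commutator mult x y) = commutator mult (L x) y + commutator mult x (L y)" for x y
    using assms(1) by (auto simp: lie_derivation_def)
  have D: "module_hom scale scale D" "D (mult x y) = mult (D x) y + mult x (D y)" for x y
    using assms(2) by (auto simp: derivation_def)
  have "D (commutator mult x y) = commutator mult (D x) y + commutator mult x (D y)" for x y
    by (simp add: commutator_def module_hom.diff[OF D(1)] D(2))
  then show ?thesis
    using module_hom_add_diff(2)[OF L(1) D(1)] L(2)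
    by (simp add: lie_derivation_def commutator_def mult_simps)
qed

lemma derivation_add:
  assumes "derivation scale mult D" "derivation scale mult D'"
  shows "derivation scale mult (\<lambda>x. D x + D' x)"
  using assms module_hom_add_diff(1)[of D D']
  by (simp add: derivation_def mult_simps)

lemma proper_lie_derivation_if_diff_proper:
  assumes L: "lie_derivation scale mult L" and D: "derivation scale mult D"
    and proper: "proper_lie_derivation scale mult (\<lambda>x. L x - D x)"
  shows "proper_lie_derivation scale mult L"
proof -
  obtain D' \<tau> where "derivation scale mult D'" "module_hom scale scale \<tau>"
    "range \<tau> \<subseteq> center mult" "\<forall>x. L x - D x = D' x + \<tau> x"
    using proper by (auto simp: proper_lie_derivation_def)
  moreover from this(4) have "\<forall>x. L x = (D x + D' x) + \<tau> x"
    by (simp add: algebra_simps)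
  ultimately show ?thesis
    using L derivation_add[OF D] unfolding proper_lie_derivation_def by blast
qed

lemma subspace_center: "subspace (center mult)"
  by (auto simp: subspace_def center_def mult_simps)

end

context morita_context
begin

lemmas bilinear_diff_simps =
  bilinear_map_diff[OF M.lact_bilinear] bilinear_map_diff[OF M.ract_bilinear]
  bilinear_map_diff[OF N.lact_bilinear] bilinear_map_diff[OF N.ract_bilinear]
  bilinear_map_diff[OF mn_bilinear] bilinear_map_diff[OF nm_bilinear]

lemma commutator_gmat:
  "commutator (gmat_mult lM rM lN rN mn nm) (GMat a m n b) (GMat a' m' n' b') =
     GMat (a * a' + mn m n' - (a' * a + mn m' n))
          (lM a m' + rM m b' - (lM a' m + rM m' b))
          (rN n a' + lN b n' - (rN n' a + lN b' n))
          (nm n m' + b * b' - (nm n' m + b' * b))"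
  by (simp add: commutator_def gmat_mult_def minus_gmat_def)

lemma diagonal_in_center_iff:
  "GMat a 0 0 b \<in> center (gmat_mult lM rM lN rN mn nm) \<longleftrightarrow>
     a \<in> center (*) \<and> b \<in> center (*) \<and> (\<forall>m. lM a m = rM m b) \<and> (\<forall>n. rN n a = lN b n)"
  unfolding center_gmat mem_Collect_eq gmat.inject by blast

end

section \<open>Lie derivations that map the idempotent to a diagonal element\<close>

text \<open>\<open>L_idem\<close> says that \<open>L (1 \<oplus> 0)\<close> is diagonal. Any Lie derivation is brought into this form by
  subtracting an inner derivation.\<close>

locale diagonal_lie_derivation =
  morita_context scaleA scaleB scaleM scaleN lM rM lN rN mn nm
  for scaleA :: "'r::comm_ring_1 \<Rightarrow> 'a::ring_1 \<Rightarrow> 'a"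
    and scaleB :: "'r \<Rightarrow> 'b::ring_1 \<Rightarrow> 'b"
    and scaleM :: "'r \<Rightarrow> 'm::ab_group_add \<Rightarrow> 'm"
    and scaleN :: "'r \<Rightarrow> 'n::ab_group_add \<Rightarrow> 'n"
    and lM rM lN rN mn nm +
  fixes L :: "('a, 'm, 'n, 'b) gmat \<Rightarrow> ('a, 'm, 'n, 'b) gmat"
  assumes lie: "lie_derivation (gmat_scale scaleA scaleM scaleN scaleB)
      (gmat_mult lM rM lN rN mn nm) L"
    and L_idem: "entryM (L (GMat 1 0 0 0)) = 0" "entryN (L (GMat 1 0 0 0)) = 0"
    and torsion_M: "two_torsion_free (UNIV :: 'm set)"
    and torsion_N: "two_torsion_free (UNIV :: 'n set)"
begin

abbreviation gscale where "gscale \<equiv> gmat_scale scaleA scaleM scaleN scaleB"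
abbreviation gmult where "gmult \<equiv> gmat_mult lM rM lN rN mn nm"

sublocale G: unital_algebra gscale gmult "GMat 1 0 0 1"
  by (rule unital_algebra_gmat)

lemma torsion: "m + m = 0 \<Longrightarrow> m = 0" "n + n = 0 \<Longrightarrow> n = 0" for m :: 'm and n :: 'n
  using torsion_M torsion_N unfolding two_torsion_free_def by blast+

lemma hom_L: "module_hom gscale gscale L"
  using lie by (simp add: lie_derivation_def)

lemma L_commutator:
  "L (commutator gmult x y) = commutator gmult (L x) y + commutator gmult x (L y)"
  using lie by (simp add: lie_derivation_def)

lemmas L_add = module_hom.add[OF hom_L]
lemmas L_scale = module_hom.scale[OF hom_L]
lemmas L_neg = module_hom.neg[OF hom_L]
lemmas L_zero = module_hom.zero[OF hom_L]

lemmas mat_simps = commutator_gmat bilinear_simps bilinear_diff_simps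
  M.lact_one M.ract_one N.lact_one N.ract_one
  plus_gmat_def minus_gmat_def uminus_gmat_def zero_gmat_def

text \<open>The components of \<open>L\<close>: \<open>\<delta>\<close> and \<open>h\<close> are the diagonal entries of its restriction to \<open>A\<close>, \<open>k\<close> and
  \<open>\<epsilon>\<close> those of its restriction to \<open>B\<close>, and \<open>f\<close>, \<open>g\<close> are its restrictions to \<open>M\<close>, \<open>N\<close>. All other entries
  are shown to vanish in \<open>L_GMat\<close>.\<close>

definition \<delta> :: "'a \<Rightarrow> 'a" where "\<delta> a = entryA (L (GMat a 0 0 0))"
definition h :: "'a \<Rightarrow> 'b" where "h a = entryB (L (GMat a 0 0 0))"
definition f :: "'m \<Rightarrow> 'm" where "f m = entryM (L (GMat 0 m 0 0))"
definition g :: "'n \<Rightarrow> 'n" where "g n = entryN (L (GMat 0 0 n 0))"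
definition k :: "'b \<Rightarrow> 'a" where "k b = entryA (L (GMat 0 0 0 b))"
definition \<epsilon> :: "'b \<Rightarrow> 'b" where "\<epsilon> b = entryB (L (GMat 0 0 0 b))"

lemma L_idem_diagonal: "L (GMat 1 0 0 0) = GMat (\<delta> 1) 0 0 (h 1)"
  using L_idem by (cases "L (GMat 1 0 0 0)") (simp add: \<delta>_def h_def)

lemma L_A: "L (GMat a 0 0 0) = GMat (\<delta> a) 0 0 (h a)"
proof (cases "L (GMat a 0 0 0)")
  case (GMat x y z w)
  have "commutator gmult (GMat 1 0 0 0) (GMat a 0 0 0) = 0"
    by (simp add: mat_simps)
  then have "0 = commutator gmult (GMat (\<delta> 1) 0 0 (h 1)) (GMat a 0 0 0)
      + commutator gmult (GMat 1 0 0 0) (GMat x y z w)"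
    using L_commutator[of "GMat 1 0 0 0" "GMat a 0 0 0"] by (simp add: L_idem_diagonal GMat L_zero)
  then have "y = 0" "z = 0"
    by (simp_all add: mat_simps)
  then show ?thesis
    using GMat by (simp add: \<delta>_def h_def)
qed

lemma L_B: "L (GMat 0 0 0 b) = GMat (k b) 0 0 (\<epsilon> b)"
proof (cases "L (GMat 0 0 0 b)")
  case (GMat x y z w)
  have "commutator gmult (GMat 1 0 0 0) (GMat 0 0 0 b) = 0"
    by (simp add: mat_simps)
  then have "0 = commutator gmult (GMat (\<delta> 1) 0 0 (h 1)) (GMat 0 0 0 b)
      + commutator gmult (GMat 1 0 0 0) (GMat x y z w)"
    using L_commutator[of "GMat 1 0 0 0" "GMat 0 0 0 b"] by (simp add: L_idem_diagonal GMat L_zero)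
  then have "y = 0" "z = 0"
    by (simp_all add: mat_simps)
  then show ?thesis
    using GMat by (simp add: k_def \<epsilon>_def)
qed

lemma L_M: "L (GMat 0 m 0 0) = GMat 0 (f m) 0 0"
proof (cases "L (GMat 0 m 0 0)")
  case (GMat x y z w)
  have "commutator gmult (GMat 1 0 0 0) (GMat 0 m 0 0) = GMat 0 m 0 0"
    by (simp add: mat_simps)
  then have "GMat x y z w = commutator gmult (GMat (\<delta> 1) 0 0 (h 1)) (GMat 0 m 0 0)
      + commutator gmult (GMat 1 0 0 0) (GMat x y z w)"
    using L_commutator[of "GMat 1 0 0 0" "GMat 0 m 0 0"] by (simp add: L_idem_diagonal GMat)
  then have "x = 0" "w = 0" "z + z = 0"
    by (simp_all add: mat_simps eq_neg_iff_add_eq_0)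
  moreover from this(3) have "z = 0"
    by (rule torsion)
  ultimately show ?thesis
    using GMat by (simp add: f_def)
qed

lemma L_N: "L (GMat 0 0 n 0) = GMat 0 0 (g n) 0"
proof (cases "L (GMat 0 0 n 0)")
  case (GMat x y z w)
  have "commutator gmult (GMat 1 0 0 0) (GMat 0 0 n 0) = - GMat 0 0 n 0"
    by (simp add: mat_simps)
  then have "- GMat x y z w = commutator gmult (GMat (\<delta> 1) 0 0 (h 1)) (GMat 0 0 n 0)
      + commutator gmult (GMat 1 0 0 0) (GMat x y z w)"
    using L_commutator[of "GMat 1 0 0 0" "GMat 0 0 n 0"]
    by (simp add: L_idem_diagonal GMat L_neg)
  then have "x = 0" "w = 0" "y + y = 0"
    by (simp_all add: mat_simps neg_eq_iff_add_eq_0)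
  moreover from this(3) have "y = 0"
    by (rule torsion)
  ultimately show ?thesis
    using GMat by (simp add: g_def)
qed

lemma L_GMat: "L (GMat a m n b) = GMat (\<delta> a + k b) (f m) (g n) (h a + \<epsilon> b)"
proof -
  have "L (GMat a m n b) = L (GMat a 0 0 0 + GMat 0 m 0 0 + GMat 0 0 n 0 + GMat 0 0 0 b)"
    by (simp add: plus_gmat_def)
  also have "\<dots> = GMat (\<delta> a + k b) (f m) (g n) (h a + \<epsilon> b)"
    unfolding L_add L_A L_M L_N L_B by (simp add: plus_gmat_def)
  finally show ?thesis .
qed

lemma component_zero [simp]: "\<delta> 0 = 0" "h 0 = 0" "f 0 = 0" "g 0 = 0" "k 0 = 0" "\<epsilon> 0 = 0"
  using L_A[of 0] L_M[of 0] L_N[of 0] L_B[of 0] L_zero by (simp_all add: zero_gmat_def)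

lemma component_add:
  "\<delta> (a + a') = \<delta> a + \<delta> a'" "h (a + a') = h a + h a'" "f (m + m') = f m + f m'"
  "g (n + n') = g n + g n'" "k (b + b') = k b + k b'" "\<epsilon> (b + b') = \<epsilon> b + \<epsilon> b'"
  using L_add[of "GMat a 0 0 0" "GMat a' 0 0 0"] L_add[of "GMat 0 m 0 0" "GMat 0 m' 0 0"]
    L_add[of "GMat 0 0 n 0" "GMat 0 0 n' 0"] L_add[of "GMat 0 0 0 b" "GMat 0 0 0 b'"]
  by (simp_all add: plus_gmat_def L_GMat)

lemma component_scale:
  "\<delta> (scaleA r a) = scaleA r (\<delta> a)" "h (scaleA r a) = scaleB r (h a)"
  "f (scaleM r m) = scaleM r (f m)" "g (scaleN r n) = scaleN r (g n)"
  "k (scaleB r b) = scaleA r (k b)" "\<epsilon> (scaleB r b) = scaleB r (\<epsilon> b)"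
  using L_scale[of r "GMat a 0 0 0"] L_scale[of r "GMat 0 m 0 0"]
    L_scale[of r "GMat 0 0 n 0"] L_scale[of r "GMat 0 0 0 b"]
  by (simp_all add: gmat_scale_def L_GMat)

lemma component_neg: "k (- b) = - k b" "\<epsilon> (- b) = - \<epsilon> b"
  using L_neg[of "GMat 0 0 0 b"]
  by (simp_all add: uminus_gmat_def L_GMat)

lemma h_k_central: "h a \<in> center (*)" "k b \<in> center (*)"
proof -
  have "h a * b = b * h a" "k b * a = a * k b" for a b
    using L_commutator[of "GMat a 0 0 0" "GMat 0 0 0 b"]
    by (simp_all add: mat_simps L_GMat)
  then show "h a \<in> center (*)" "k b \<in> center (*)"
    by (auto simp: center_def)
qed

lemma f_lM: "f (lM a m) = lM (\<delta> a) m - rM m (h a) + lM a (f m)"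
  using L_commutator[of "GMat a 0 0 0" "GMat 0 m 0 0"] by (simp add: mat_simps L_GMat)

lemma f_rM: "f (rM m b) = rM (f m) b + (rM m (\<epsilon> b) - lM (k b) m)"
  using L_commutator[of "GMat 0 m 0 0" "GMat 0 0 0 b"] by (simp add: mat_simps L_GMat)

lemma g_rN: "g (rN n a) = rN (g n) a + (rN n (\<delta> a) - lN (h a) n)"
  using L_commutator[of "GMat 0 0 n 0" "GMat a 0 0 0"] by (simp add: mat_simps L_GMat)

lemma g_lN: "g (lN b n) = lN (\<epsilon> b) n - rN n (k b) + lN b (g n)"
  using L_commutator[of "GMat 0 0 0 b" "GMat 0 0 n 0"] by (simp add: mat_simps L_GMat)

lemma \<delta>_mn: "\<delta> (mn m n) - k (nm n m) = mn (f m) n + mn m (g n)"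
  and \<epsilon>_nm: "\<epsilon> (nm n m) - h (mn m n) = nm n (f m) + nm (g n) m"
  using L_commutator[of "GMat 0 m 0 0" "GMat 0 0 n 0"]
  by (simp_all add: mat_simps L_GMat component_neg algebra_simps)

end

section \<open>Splitting off the central part\<close>

text \<open>The additional assumptions are those that provide the central partners: existence follows from
  the surjectivity of the projections of the center, uniqueness from faithfulness.\<close>

locale faithful_diagonal_lie_derivation =
  diagonal_lie_derivation scaleA scaleB scaleM scaleN lM rM lN rN mn nm L
  for scaleA :: "'r::comm_ring_1 \<Rightarrow> 'a::ring_1 \<Rightarrow> 'a"
    and scaleB :: "'r \<Rightarrow> 'b::ring_1 \<Rightarrow> 'b"
    and scaleM :: "'r \<Rightarrow> 'm::ab_group_add \<Rightarrow> 'm"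
    and scaleN :: "'r \<Rightarrow> 'n::ab_group_add \<Rightarrow> 'n"
    and lM rM lN rN mn nm L +
  assumes faithful: "faithful_bimodule lM rM"
    and proj_A: "entryA ` center (gmat_mult lM rM lN rN mn nm) = center (*)"
    and proj_B: "entryB ` center (gmat_mult lM rM lN rN mn nm) = center (*)"
begin

lemma faithful_eqI_A:
  assumes "\<And>m. lM a m = lM a' m" shows "a = a'"
proof -
  have "\<forall>m. lM (a - a') m = 0"
    using assms by (simp add: bilinear_diff_simps)
  then have "a - a' = 0"
    using faithful unfolding faithful_bimodule_def by blast
  then show ?thesis by simp
qed

lemma faithful_eqI_B:
  assumes "\<And>m. rM m b = rM m b'" shows "b = b'"
proof -
  have "\<forall>m. rM m (b - b') = 0"
    using assms by (simp add: bilinear_diff_simps)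
  then have "b - b' = 0"
    using faithful unfolding faithful_bimodule_def by blast
  then show ?thesis by simp
qed

lemma central_unique:
  "GMat a 0 0 b \<in> center gmult \<Longrightarrow> GMat a' 0 0 b \<in> center gmult \<Longrightarrow> a = a'"
  "GMat a 0 0 b \<in> center gmult \<Longrightarrow> GMat a 0 0 b' \<in> center gmult \<Longrightarrow> b = b'"
  by (auto simp: diagonal_in_center_iff intro: faithful_eqI_A faithful_eqI_B)

text \<open>The central partners of elements of \<open>Z(B)\<close> and of \<open>Z(A)\<close>; off these centers the values are
  arbitrary.\<close>

definition \<phi> :: "'b \<Rightarrow> 'a" where "\<phi> b = (SOME a. GMat a 0 0 b \<in> center gmult)"
definition \<psi> :: "'a \<Rightarrow> 'b" where "\<psi> a = (SOME b. GMat a 0 0 b \<in> center gmult)"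

lemma \<phi>_central: "b \<in> center (*) \<Longrightarrow> GMat (\<phi> b) 0 0 b \<in> center gmult"
proof -
  assume "b \<in> center (*)"
  then obtain x where "x \<in> center gmult" "b = entryB x"
    using proj_B by blast
  then have "\<exists>a. GMat a 0 0 b \<in> center gmult"
    by (auto simp: center_gmat)
  then show ?thesis
    unfolding \<phi>_def by (rule someI_ex)
qed

lemma \<psi>_central: "a \<in> center (*) \<Longrightarrow> GMat a 0 0 (\<psi> a) \<in> center gmult"
proof -
  assume "a \<in> center (*)"
  then obtain x where "x \<in> center gmult" "a = entryA x"
    using proj_A by blast
  then have "\<exists>b. GMat a 0 0 b \<in> center gmult"
    by (auto simp: center_gmat)
  then show ?thesis
    unfolding \<psi>_def by (rule someI_ex)
qed

lemma h_central: "GMat (\<phi> (h a)) 0 0 (h a) \<in> center gmult"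
  by (intro \<phi>_central h_k_central)

lemma k_central: "GMat (k b) 0 0 (\<psi> (k b)) \<in> center gmult"
  by (intro \<psi>_central h_k_central)

lemma \<phi>_h_linear:
  "\<phi> (h a + h a') = \<phi> (h a) + \<phi> (h a')" "\<phi> (scaleB r (h a)) = scaleA r (\<phi> (h a))"
proof -
  show "\<phi> (h a + h a') = \<phi> (h a) + \<phi> (h a')"
    using h_central[of "a + a'"] G.subspace_add[OF G.subspace_center h_central[of a] h_central[of a']]
    by (simp add: component_add plus_gmat_def central_unique)
  show "\<phi> (scaleB r (h a)) = scaleA r (\<phi> (h a))"
    using h_central[of "scaleA r a"] G.subspace_scale[OF G.subspace_center h_central[of a], of r]
    by (simp add: component_scale gmat_scale_def central_unique)
qed

lemma \<psi>_k_linear: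
  "\<psi> (k b + k b') = \<psi> (k b) + \<psi> (k b')" "\<psi> (scaleA r (k b)) = scaleB r (\<psi> (k b))"
proof -
  show "\<psi> (k b + k b') = \<psi> (k b) + \<psi> (k b')"
    using k_central[of "b + b'"] G.subspace_add[OF G.subspace_center k_central[of b] k_central[of b']]
    by (simp add: component_add plus_gmat_def central_unique)
  show "\<psi> (scaleA r (k b)) = scaleB r (\<psi> (k b))"
    using k_central[of "scaleB r b"] G.subspace_scale[OF G.subspace_center k_central[of b], of r]
    by (simp add: component_scale gmat_scale_def central_unique)
qed

text \<open>The diagonal components, corrected by the central partners of \<open>h\<close> and \<open>k\<close>. The correction turns
  the identities for \<open>f\<close> and \<open>g\<close> into Leibniz rules, and by faithfulness \<open>d\<close> and \<open>e\<close> are derivations.\<close>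

definition d :: "'a \<Rightarrow> 'a" where "d a = \<delta> a - \<phi> (h a)"
definition e :: "'b \<Rightarrow> 'b" where "e b = \<epsilon> b - \<psi> (k b)"

lemma f_lM_d: "f (lM a m) = lM (d a) m + lM a (f m)"
  using f_lM[of a m] h_central[of a]
  by (simp add: d_def bilinear_diff_simps diagonal_in_center_iff)

lemma f_rM_e: "f (rM m b) = rM (f m) b + rM m (e b)"
  using f_rM[of m b] k_central[of b]
  by (simp add: e_def bilinear_diff_simps diagonal_in_center_iff)

lemma g_rN_d: "g (rN n a) = rN (g n) a + rN n (d a)"
  using g_rN[of n a] h_central[of a]
  by (simp add: d_def bilinear_diff_simps diagonal_in_center_iff)

lemma g_lN_e: "g (lN b n) = lN (e b) n + lN b (g n)"
  using g_lN[of b n] k_central[of b]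
  by (simp add: e_def bilinear_diff_simps diagonal_in_center_iff)

lemma d_mult: "d (a * a') = d a * a' + a * d a'"
proof (rule faithful_eqI_A)
  fix m
  have "lM (d (a * a')) m + lM (a * a') (f m) = f (lM a (lM a' m))"
    using f_lM_d[of "a * a'" m] by (simp add: M.lact_mult)
  also have "\<dots> = lM (d a * a' + a * d a') m + lM (a * a') (f m)"
    by (simp add: f_lM_d bilinear_simps M.lact_mult add.assoc)
  finally show "lM (d (a * a')) m = lM (d a * a' + a * d a') m"
    by simp
qed

lemma e_mult: "e (b * b') = e b * b' + b * e b'"
proof (rule faithful_eqI_B)
  fix m
  have "rM (f m) (b * b') + rM m (e (b * b')) = f (rM (rM m b) b')"
    using f_rM_e[of m "b * b'"] by (simp add: M.ract_mult)
  also have "\<dots> = rM (f m) (b * b') + rM m (e b * b' + b * e b')"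
    by (simp add: f_rM_e bilinear_simps M.ract_mult add.assoc)
  finally show "rM m (e (b * b')) = rM m (e b * b' + b * e b')"
    by simp
qed

text \<open>\<open>z m n \<oplus> w m n\<close> is the central defect in the Leibniz rule for the products \<open>mn\<close> and \<open>nm\<close>.\<close>

definition z :: "'m \<Rightarrow> 'n \<Rightarrow> 'a" where "z m n = \<phi> (h (mn m n)) - k (nm n m)"
definition w :: "'m \<Rightarrow> 'n \<Rightarrow> 'b" where "w m n = h (mn m n) - \<psi> (k (nm n m))"

lemma defect_central: "GMat (z m n) 0 0 (w m n) \<in> center gmult"
  using G.subspace_diff[OF G.subspace_center h_central[of "mn m n"] k_central[of "nm n m"]]
  by (simp add: z_def w_def minus_gmat_def)

lemma d_mn: "d (mn m n) = mn (f m) n + mn m (g n) - z m n"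
  using \<delta>_mn[of m n] by (simp add: d_def z_def algebra_simps)

lemma e_nm: "e (nm n m) = nm n (f m) + nm (g n) m + w m n"
  using \<epsilon>_nm[of n m] by (simp add: e_def w_def algebra_simps)

text \<open>This is where the associativity of the Morita context, \<open>(mn) m = m (nm)\<close>, enters: the defect
  appears with opposite signs in \<open>d (mn)\<close> and \<open>e (nm)\<close>, so comparing the two expansions doubles
  \<open>z m\<close> instead of cancelling it.\<close>

lemma z_annihilates: "lM (z m n) m = 0"
proof -
  have zw: "lM (z m n) m = rM m (w m n)"
    using defect_central[of m n] by (simp add: diagonal_in_center_iff)
  \<comment> \<open>The two sides expand \<open>f ((mn) m)\<close> and \<open>f (m (nm))\<close>.\<close>
  have "lM (d (mn m n)) m + lM (mn m n) (f m) = rM (f m) (nm n m) + rM m (e (nm n m))"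
    using f_lM_d[of "mn m n" m] f_rM_e[of m "nm n m"] by (simp add: mn_act)
  then have "lM (z m n) m + rM m (w m n) = 0"
    by (simp add: d_mn e_nm bilinear_simps bilinear_diff_simps mn_act algebra_simps)
  with zw have "lM (z m n) m + lM (z m n) m = 0"
    by simp
  then show ?thesis
    by (rule torsion)
qed

lemma defect_zero:
  assumes domA: "is_domain ((*) :: 'a \<Rightarrow> 'a \<Rightarrow> 'a)" and domB: "is_domain ((*) :: 'b \<Rightarrow> 'b \<Rightarrow> 'b)"
  shows "z m n = 0" "w m n = 0"
proof -
  have zw: "lM (z m n) m' = rM m' (w m n)" for m'
    using defect_central[of m n] by (simp add: diagonal_in_center_iff)
  have zero_iff: "z m n = 0 \<longleftrightarrow> w m n = 0"
  proof
    assume "z m n = 0"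
    then show "w m n = 0"
      using zw by (intro faithful_eqI_B) (simp add: bilinear_simps)
  next
    assume "w m n = 0"
    then show "z m n = 0"
      using zw by (intro faithful_eqI_A) (simp add: bilinear_simps)
  qed
  have "z m n * mn m n = mn (lM (z m n) m) n"
    by (simp add: mn_left)
  then have A: "z m n = 0 \<or> mn m n = 0"
    using domA z_annihilates[of m n] by (auto simp: is_domain_def bilinear_simps)
  have "nm n m * w m n = nm n (rM m (w m n))"
    by (simp add: nm_right)
  then have B: "nm n m = 0 \<or> w m n = 0"
    using domB z_annihilates[of m n] zw[of m] by (auto simp: is_domain_def bilinear_simps)
  \<comment> \<open>The defect is a function of the two products alone.\<close>
  have "z m n = 0" if "mn m n = 0" "nm n m = 0"
  proof -
    have "\<phi> (h 0) = 0"
      using \<phi>_h_linear(1)[of 0 0] by simp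
    then show ?thesis
      using that by (simp add: z_def)
  qed
  then show "z m n = 0"
    using A B zero_iff by blast
  then show "w m n = 0"
    using zero_iff by simp
qed

lemma proper:
  assumes dom: "is_domain ((*) :: 'a \<Rightarrow> 'a \<Rightarrow> 'a)" "is_domain ((*) :: 'b \<Rightarrow> 'b \<Rightarrow> 'b)"
  shows "proper_lie_derivation gscale gmult L"
proof -
  define D where "D x = GMat (d (entryA x)) (f (entryM x)) (g (entryN x)) (e (entryB x))" for x
  have d_linear: "d (a + a') = d a + d a'" "d (scaleA r a) = scaleA r (d a)" for a a' r
    by (simp_all add: d_def component_add component_scale \<phi>_h_linear M.A.scale_right_diff_distrib)
  have e_linear: "e (b + b') = e b + e b'" "e (scaleB r b) = scaleB r (e b)" for b b' r
    by (simp_all add: e_def component_add component_scale \<psi>_k_linear M.B.scale_right_diff_distrib)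
  have hom_D: "module_hom gscale gscale D"
    by unfold_locales
      (simp_all add: D_def plus_gmat_def gmat_scale_def d_linear e_linear component_add
        component_scale)
  have "D (gmult x y) = gmult (D x) y + gmult x (D y)" for x y
    by (simp add: D_def gmat_mult_def plus_gmat_def d_linear e_linear component_add
        d_mult e_mult d_mn e_nm defect_zero[OF dom] f_lM_d f_rM_e g_rN_d g_lN_e algebra_simps)
  with hom_D have "derivation gscale gmult D"
    by (simp add: derivation_def)
  moreover have "module_hom gscale gscale (\<lambda>x. L x - D x)"
    by (intro G.module_hom_add_diff(2) hom_L hom_D)
  moreover have "L x - D x \<in> center gmult" for x
  proof (cases x)
    case (GMat a m n b)
    then have "L x - D x = GMat (\<phi> (h a)) 0 0 (h a) + GMat (k b) 0 0 (\<psi> (k b))"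
      by (simp add: L_GMat D_def d_def e_def plus_gmat_def minus_gmat_def)
    then show ?thesis
      using G.subspace_add[OF G.subspace_center h_central k_central] by simp
  qed
  ultimately show ?thesis
    using lie unfolding proper_lie_derivation_def
    by (intro conjI exI[of _ D] exI[of _ "\<lambda>x. L x - D x"]) auto
qed

end

section \<open>The Lie derivation property\<close>

theorem theorem3p2:
  fixes scaleA :: "'r::comm_ring_1 \<Rightarrow> 'a::ring_1 \<Rightarrow> 'a"
    and scaleB :: "'r \<Rightarrow> 'b::ring_1 \<Rightarrow> 'b"
    and scaleM :: "'r \<Rightarrow> 'm::ab_group_add \<Rightarrow> 'm"
    and scaleN :: "'r \<Rightarrow> 'n::ab_group_add \<Rightarrow> 'n"
    and lM :: "'a \<Rightarrow> 'm \<Rightarrow> 'm" and rM :: "'m \<Rightarrow> 'b \<Rightarrow> 'm"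
    and lN :: "'b \<Rightarrow> 'n \<Rightarrow> 'n" and rN :: "'n \<Rightarrow> 'a \<Rightarrow> 'n"
    and mn :: "'m \<Rightarrow> 'n \<Rightarrow> 'a" and nm :: "'n \<Rightarrow> 'm \<Rightarrow> 'b"
  assumes "generalized_matrix_algebra scaleA scaleB scaleM scaleN lM rM lN rN mn nm"
    and "two_torsion_free (UNIV :: 'm set)"
    and "two_torsion_free (UNIV :: 'n set)"
    and "faithful_bimodule lM rM"
    and "entryA ` center (gmat_mult lM rM lN rN mn nm) = center (*)"
    and "entryB ` center (gmat_mult lM rM lN rN mn nm) = center (*)"
    and "is_domain ((*) :: 'a \<Rightarrow> 'a \<Rightarrow> 'a)"
    and "is_domain ((*) :: 'b \<Rightarrow> 'b \<Rightarrow> 'b)"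
  shows "lie_derivation_property (gmat_scale scaleA scaleM scaleN scaleB)
           (gmat_mult lM rM lN rN mn nm)"
proof -
  let ?s = "gmat_scale scaleA scaleM scaleN scaleB"
  let ?m = "gmat_mult lM rM lN rN mn nm"
  let ?p = "GMat 1 0 0 0 :: ('a, 'm, 'n, 'b) gmat"
  interpret generalized_matrix_algebra scaleA scaleB scaleM scaleN lM rM lN rN mn nm
    by fact
  interpret G: unital_algebra ?s ?m "GMat 1 0 0 1"
    by (rule unital_algebra_gmat)
  have "proper_lie_derivation ?s ?m L" if L: "lie_derivation ?s ?m L" for L
  proof -
    define s where "s = commutator ?m (L ?p) ?p"
    let ?L' = "\<lambda>x. L x - commutator ?m s x"
    have lie: "lie_derivation ?s ?m ?L'"
      by (intro G.lie_derivation_diff_derivation L G.derivation_inner)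
    \<comment> \<open>Bracketing twice with \<open>p\<close> fixes the off-diagonal entries of \<open>L p\<close>, so they cancel in
      \<open>L p - [s, p]\<close>.\<close>
    have "entryM (?L' ?p) = 0" "entryN (?L' ?p) = 0"
      by (cases "L ?p"; simp add: s_def commutator_gmat bilinear_simps bilinear_diff_simps
          minus_gmat_def M.lact_one M.ract_one N.lact_one N.ract_one)+
    with lie interpret faithful_diagonal_lie_derivation
      scaleA scaleB scaleM scaleN lM rM lN rN mn nm ?L'
      by unfold_locales (use assms in auto)
    show ?thesis
      by (rule G.proper_lie_derivation_if_diff_proper[OF L G.derivation_inner
            proper[OF assms(7,8)]])
  qed
  then show ?thesis
    by (simp add: lie_derivation_property_def)
qed

end
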